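(* Let $(\Omega,\mu)$ be a $\sigma$-finite measure space and $p \in [1,\infty)$. Let $T: L^p \to L^p$ be a positive linear operator on the complex-valued space $L^p := L^p(\Omega,\mu)$. Assume that $T$ is power bounded and that, for each $0 \le f \in L^p$, there exists an integer $n \ge 1$ (possibly depending on $f$) such that $\operatorname{supp}(T^n f) \supseteq \operatorname{supp}(T^{n-1} f)$. Then $\sigma_{\mathrm{pnt}}(T) \cap \mathbb{T} \subseteq \{1\}$.
   Context: $\mathbb{T} := \{\lambda \in \mathbb{C} : |\lambda| = 1\}$. $\sigma_{\mathrm{pnt}}(T)$ denotes the point spectrum of $T$, i.e. the set of eigenvalues of $T$. Inequalities $\le$, $\ge$ between functions in $L^p$ are understood almost everywhere. $T$ is positive if $Tf \ge 0$ whenever $f \ge 0$. $T$ is power bounded if $\sup_{n \in \mathbb{N}_0} \|T^n\| < \infty$, where $\mathbb{N}_0 = \{0,1,2,\dots\}$. For $f \in L^p(\Omega,\mu)$ the support is $\operatorname{supp}(f) := \{\omega \in \Omega : f(\omega) \neq 0\}$, which is defined up to a $\mu$-null set; all inclusions between supports are understood up to $\mu$-null sets. *)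

theory Defs
  imports "HOL-Analysis.Analysis"
begin

text \<open>
  Elements of the complex space \<open>L\<^sup>p(\<Omega>,\<mu>)\<close> are handled through representatives: \<open>Lp M p\<close> is the
  set of \<open>p\<close>-integrable functions, and equality in \<open>L\<^sup>p(\<Omega>,\<mu>)\<close> is equality almost everywhere.
\<close>

definition Lp :: "'a measure \<Rightarrow> real \<Rightarrow> ('a \<Rightarrow> complex) set" where
  "Lp M p = {f \<in> borel_measurable M. integrable M (\<lambda>x. norm (f x) powr p)}"

definition Lp_norm :: "'a measure \<Rightarrow> real \<Rightarrow> ('a \<Rightarrow> complex) \<Rightarrow> real" where
  "Lp_norm M p f = (\<integral>x. norm (f x) powr p \<partial>M) powr (1 / p)"

definition ae_eq :: "'a measure \<Rightarrow> ('a \<Rightarrow> complex) \<Rightarrow> ('a \<Rightarrow> complex) \<Rightarrow> bool" where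
  "ae_eq M f g \<longleftrightarrow> (AE x in M. f x = g x)"

definition ae_nonneg :: "'a measure \<Rightarrow> ('a \<Rightarrow> complex) \<Rightarrow> bool" where
  "ae_nonneg M f \<longleftrightarrow> (AE x in M. f x \<in> \<real>\<^sub>\<ge>\<^sub>0)"

definition supp :: "'a measure \<Rightarrow> ('a \<Rightarrow> complex) \<Rightarrow> 'a set" where
  "supp M f = {x \<in> space M. f x \<noteq> 0}"

definition ae_subset :: "'a measure \<Rightarrow> 'a set \<Rightarrow> 'a set \<Rightarrow> bool" where
  "ae_subset M A B \<longleftrightarrow> (AE x in M. x \<in> A \<longrightarrow> x \<in> B)"

text \<open>
  The second conjunct says that \<open>T\<close> is well defined on classes modulo equality almost everywhere.
  The values of \<open>T\<close> outside \<open>Lp M p\<close> are irrelevant. Boundedness is not part of the definition.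
\<close>

definition Lp_linear_operator ::
    "'a measure \<Rightarrow> real \<Rightarrow> (('a \<Rightarrow> complex) \<Rightarrow> ('a \<Rightarrow> complex)) \<Rightarrow> bool" where
  "Lp_linear_operator M p T \<longleftrightarrow>
     (\<forall>f\<in>Lp M p. T f \<in> Lp M p) \<and>
     (\<forall>f\<in>Lp M p. \<forall>g\<in>Lp M p. ae_eq M f g \<longrightarrow> ae_eq M (T f) (T g)) \<and>
     (\<forall>f\<in>Lp M p. \<forall>g\<in>Lp M p. ae_eq M (T (\<lambda>x. f x + g x)) (\<lambda>x. T f x + T g x)) \<and>
     (\<forall>c. \<forall>f\<in>Lp M p. ae_eq M (T (\<lambda>x. c * f x)) (\<lambda>x. c * T f x))"

definition positive_operator ::
    "'a measure \<Rightarrow> real \<Rightarrow> (('a \<Rightarrow> complex) \<Rightarrow> ('a \<Rightarrow> complex)) \<Rightarrow> bool" where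
  "positive_operator M p T \<longleftrightarrow> (\<forall>f\<in>Lp M p. ae_nonneg M f \<longrightarrow> ae_nonneg M (T f))"

text \<open>The operator norm takes values in \<open>[0,\<infinity>]\<close>, being \<open>\<infinity>\<close> exactly for unbounded operators.\<close>

definition operator_norm ::
    "'a measure \<Rightarrow> real \<Rightarrow> (('a \<Rightarrow> complex) \<Rightarrow> ('a \<Rightarrow> complex)) \<Rightarrow> ennreal" where
  "operator_norm M p T = (SUP f\<in>{f \<in> Lp M p. Lp_norm M p f \<le> 1}. ennreal (Lp_norm M p (T f)))"

definition power_bounded ::
    "'a measure \<Rightarrow> real \<Rightarrow> (('a \<Rightarrow> complex) \<Rightarrow> ('a \<Rightarrow> complex)) \<Rightarrow> bool" where
  "power_bounded M p T \<longleftrightarrow> (SUP n. operator_norm M p (T ^^ n)) < \<infinity>"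

definition point_spectrum ::
    "'a measure \<Rightarrow> real \<Rightarrow> (('a \<Rightarrow> complex) \<Rightarrow> ('a \<Rightarrow> complex)) \<Rightarrow> complex set" where
  "point_spectrum M p T =
     {l. \<exists>f\<in>Lp M p. \<not> ae_eq M f (\<lambda>x. 0) \<and> ae_eq M (T f) (\<lambda>x. l * f x)}"

end

theory Submission
  imports Defs
begin

text \<open>
  Let \<open>T f = \<lambda> f\<close> with \<open>|\<lambda>| = 1\<close> and \<open>f \<noteq> 0\<close>. Positivity gives \<open>|f| \<le> T |f|\<close>, so the functions
  \<open>T\<^sup>n |f|\<close> increase. Since they are bounded in \<open>L\<^sup>p\<close>, they converge in norm to some \<open>h \<ge> |f|\<close> with
  \<open>T h = h\<close> (lemma \<open>fixed_majorant\<close>). Moreover \<open>T\<^sup>n (h - |f|) = h - T\<^sup>n |f|\<close> tends to \<open>0\<close>, that is,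
  \<open>h - |f|\<close> lies in the closed ideal \<open>J\<close> of all \<open>g\<close> such that \<open>T\<^sup>n |g|\<close> tends to \<open>0\<close> in norm. As a closed ideal of \<open>L\<^sup>p\<close>, \<open>J\<close> is determined by supports: a function supported where some
  member of \<open>J\<close> is nonzero belongs to \<open>J\<close> (lemma \<open>vanishing_band\<close>). Thus, modulo \<open>J\<close>, the
  function \<open>|f|\<close> itself is a fixed point of \<open>T\<close>.

  Write \<open>u = f / h\<close>, a function with values in the closed unit disc, and let \<open>N\<close> be the set where
  \<open>|f| < h\<close>. Outside \<open>N\<close> the value \<open>\<lambda> u(x)\<close> is an average of values of \<open>u\<close> and has modulus one,
  the largest modulus possible, so the average only sees points at which \<open>u\<close> equals \<open>\<lambda> u(x)\<close>.
  Hence a function \<open>0 \<le> g \<le> h\<close> supported where \<open>u\<close> is close to \<open>\<zeta>\<close> is mapped by \<open>T\<^sup>m\<close> to one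
  which, outside \<open>N\<close>, is supported where \<open>\<lambda>\<^sup>m u\<close> is close to \<open>\<zeta>\<close>. This is
  proved by comparing \<open>g\<close> with the positive functions \<open>h - Re (cnj \<theta> * f)\<close>, with \<open>\<theta>\<close> in a countable
  dense subset of the circle (lemma \<open>localisation\<close>).

  If \<open>\<lambda> \<noteq> 1\<close> and "close" means closer than a suitable multiple of \<open>|\<lambda> - 1|\<close>, the supports of
  \<open>T\<^sup>m g\<close> and \<open>T\<^sup>m\<^sup>+\<^sup>1 g\<close> are disjoint outside \<open>N\<close>. For the \<open>m\<close> at which the support condition says
  that the first is contained in the second, \<open>T\<^sup>m g\<close> is therefore supported in \<open>N\<close>, so \<open>T\<^sup>m g\<close> and
  with it \<open>g\<close> lie in \<open>J\<close> (lemma \<open>vanishing_localised\<close>). Finitely many small discs cover the unit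
  disc, so \<open>h\<close> is dominated by a finite sum of such \<open>g\<close> and lies in \<open>J\<close>. But \<open>h\<close> is fixed, whence
  \<open>h = 0\<close> and \<open>f = 0\<close>, a contradiction.
\<close>

section \<open>Real functions with integrable p-th power\<close>

text \<open>
  All size estimates are made for the \<open>p\<close>-th power of the norm. It satisfies only a quasi-triangle
  inequality, with constant \<open>2\<^sup>p\<close>, but this suffices for every convergence argument below.
\<close>

definition real_Lp :: "'a measure \<Rightarrow> real \<Rightarrow> ('a \<Rightarrow> real) set" where
  "real_Lp M p = {g \<in> borel_measurable M. integrable M (\<lambda>x. \<bar>g x\<bar> powr p)}"

definition pth_power_integral :: "'a measure \<Rightarrow> real \<Rightarrow> ('a \<Rightarrow> real) \<Rightarrow> real" where
  "pth_power_integral M p g = (\<integral>x. \<bar>g x\<bar> powr p \<partial>M)"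

lemma real_Lp_measurable: "g \<in> real_Lp M p \<Longrightarrow> g \<in> borel_measurable M"
  by (simp add: real_Lp_def)

lemma real_LpD: "g \<in> real_Lp M p \<Longrightarrow> integrable M (\<lambda>x. \<bar>g x\<bar> powr p)"
  by (simp add: real_Lp_def)

lemma Lp_measurable: "f \<in> Lp M p \<Longrightarrow> f \<in> borel_measurable M"
  by (simp add: Lp_def)

lemma of_real_in_Lp_iff: "(\<lambda>x. complex_of_real (g x)) \<in> Lp M p \<longleftrightarrow> g \<in> real_Lp M p"
proof -
  have "g \<in> borel_measurable M" if [measurable]: "(\<lambda>x. complex_of_real (g x)) \<in> borel_measurable M"
  proof -
    have "(\<lambda>x. Re (complex_of_real (g x))) \<in> borel_measurable M" by measurable
    then show ?thesis by simp
  qed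
  moreover have "(\<lambda>x. complex_of_real (g x)) \<in> borel_measurable M"
    if [measurable]: "g \<in> borel_measurable M"
    by measurable
  ultimately have "(\<lambda>x. complex_of_real (g x)) \<in> borel_measurable M \<longleftrightarrow> g \<in> borel_measurable M"
    by (rule iffI)
  then show ?thesis by (simp add: Lp_def real_Lp_def)
qed

lemma norm_in_real_Lp: "f \<in> Lp M p \<Longrightarrow> (\<lambda>x. norm (f x)) \<in> real_Lp M p"
  by (auto simp: Lp_def real_Lp_def)

lemma real_Lp_dominated:
  assumes "0 \<le> p" "h \<in> real_Lp M p" "g \<in> borel_measurable M" "AE x in M. \<bar>g x\<bar> \<le> \<bar>h x\<bar>"
  shows "g \<in> real_Lp M p" "pth_power_integral M p g \<le> pth_power_integral M p h"
proof -
  note [measurable] = assms(3)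
  have le: "AE x in M. \<bar>g x\<bar> powr p \<le> \<bar>h x\<bar> powr p"
    using assms(4) by eventually_elim (use assms(1) in \<open>auto intro: powr_mono2\<close>)
  have "integrable M (\<lambda>x. \<bar>g x\<bar> powr p)"
    by (rule Bochner_Integration.integrable_bound[OF real_LpD[OF assms(2)]])
       (use le in auto)
  then show "g \<in> real_Lp M p" using assms(3) by (simp add: real_Lp_def)
  show "pth_power_integral M p g \<le> pth_power_integral M p h"
    unfolding pth_power_integral_def
    by (rule integral_mono_AE[OF \<open>integrable M (\<lambda>x. \<bar>g x\<bar> powr p)\<close> real_LpD[OF assms(2)] le])
qed

lemma Re_in_real_Lp: "0 \<le> p \<Longrightarrow> f \<in> Lp M p \<Longrightarrow> (\<lambda>x. Re (f x)) \<in> real_Lp M p"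
  by (rule real_Lp_dominated(1)[OF _ norm_in_real_Lp])
     (auto dest: Lp_measurable simp: abs_Re_le_cmod)

lemma Im_in_real_Lp: "0 \<le> p \<Longrightarrow> f \<in> Lp M p \<Longrightarrow> (\<lambda>x. Im (f x)) \<in> real_Lp M p"
  by (rule real_Lp_dominated(1)[OF _ norm_in_real_Lp])
     (auto dest: Lp_measurable simp: abs_Im_le_cmod)

lemma powr_add_le:
  fixes a b :: real
  assumes "0 \<le> p" "0 \<le> a" "0 \<le> b"
  shows "(a + b) powr p \<le> 2 powr p * (a powr p + b powr p)"
proof -
  have "(a + b) powr p \<le> (2 * max a b) powr p"
    using assms by (intro powr_mono2) auto
  also have "\<dots> = 2 powr p * (max a b) powr p"
    using assms by (simp add: powr_mult)
  also have "\<dots> \<le> 2 powr p * (a powr p + b powr p)"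
    by (intro mult_left_mono) (auto simp: max_def)
  finally show ?thesis .
qed

lemma real_Lp_add:
  assumes "0 \<le> p" "g \<in> real_Lp M p" "h \<in> real_Lp M p"
  shows "(\<lambda>x. g x + h x) \<in> real_Lp M p"
    and "pth_power_integral M p (\<lambda>x. g x + h x)
           \<le> 2 powr p * (pth_power_integral M p g + pth_power_integral M p h)"
proof -
  note [measurable] = real_Lp_measurable[OF assms(2)] real_Lp_measurable[OF assms(3)]
  note int = real_LpD[OF assms(2)] real_LpD[OF assms(3)]
  have bound: "\<bar>g x + h x\<bar> powr p \<le> 2 powr p * (\<bar>g x\<bar> powr p + \<bar>h x\<bar> powr p)" for x
    by (rule order_trans[OF powr_mono2 powr_add_le]) (use assms(1) in auto)
  have "integrable M (\<lambda>x. 2 powr p * (\<bar>g x\<bar> powr p + \<bar>h x\<bar> powr p))"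
    using int by auto
  then have "integrable M (\<lambda>x. \<bar>g x + h x\<bar> powr p)"
    by (rule Bochner_Integration.integrable_bound) (use bound in auto)
  then show "(\<lambda>x. g x + h x) \<in> real_Lp M p"
    by (simp add: real_Lp_def)
  have "pth_power_integral M p (\<lambda>x. g x + h x)
      \<le> (\<integral>x. 2 powr p * (\<bar>g x\<bar> powr p + \<bar>h x\<bar> powr p) \<partial>M)"
    unfolding pth_power_integral_def
    by (rule integral_mono) (use bound \<open>integrable M (\<lambda>x. \<bar>g x + h x\<bar> powr p)\<close> int in auto)
  also have "\<dots> = 2 powr p * (pth_power_integral M p g + pth_power_integral M p h)"
    using int by (simp add: pth_power_integral_def)
  finally show "pth_power_integral M p (\<lambda>x. g x + h x)
           \<le> 2 powr p * (pth_power_integral M p g + pth_power_integral M p h)" .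
qed

lemma real_Lp_cmult:
  assumes "g \<in> real_Lp M p"
  shows "(\<lambda>x. c * g x) \<in> real_Lp M p"
    and "pth_power_integral M p (\<lambda>x. c * g x) = \<bar>c\<bar> powr p * pth_power_integral M p g"
  using assms by (auto simp: real_Lp_def pth_power_integral_def abs_mult powr_mult)

lemma real_Lp_diff:
  assumes "0 \<le> p" "g \<in> real_Lp M p" "h \<in> real_Lp M p"
  shows "(\<lambda>x. g x - h x) \<in> real_Lp M p"
  using real_Lp_add(1)[OF assms(1,2) real_Lp_cmult(1)[OF assms(3), of "-1"]] by simp

lemma pth_power_integral_cong:
  assumes "g \<in> real_Lp M p" "h \<in> real_Lp M p" "AE x in M. g x = h x"
  shows "pth_power_integral M p g = pth_power_integral M p h"
proof -
  note [measurable] = real_Lp_measurable[OF assms(1)] real_Lp_measurable[OF assms(2)]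
  show ?thesis unfolding pth_power_integral_def
    by (rule integral_cong_AE) (use assms(3) in auto)
qed

lemma pth_power_integral_nonneg: "0 \<le> pth_power_integral M p g"
  by (simp add: pth_power_integral_def)

lemma pth_power_integral_eq_0D:
  assumes "g \<in> real_Lp M p" "pth_power_integral M p g = 0"
  shows "AE x in M. g x = 0"
proof -
  have "AE x in M. \<bar>g x\<bar> powr p = 0"
    using integral_nonneg_eq_0_iff_AE[OF real_LpD[OF assms(1)]] assms(2)
    by (simp add: pth_power_integral_def)
  then show ?thesis by simp
qed

lemma Lp_add:
  assumes "0 \<le> p" "f \<in> Lp M p" "g \<in> Lp M p"
  shows "(\<lambda>x. f x + g x) \<in> Lp M p"
proof -
  note [measurable] = Lp_measurable[OF assms(2)] Lp_measurable[OF assms(3)]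
  have "(\<lambda>x. norm (f x + g x)) \<in> real_Lp M p"
    by (rule real_Lp_dominated(1)[OF assms(1) real_Lp_add(1)[OF assms(1)
              norm_in_real_Lp[OF assms(2)] norm_in_real_Lp[OF assms(3)]]])
       (auto simp: norm_triangle_ineq)
  then show ?thesis by (simp add: real_Lp_def Lp_def)
qed

lemma Lp_cmult: "f \<in> Lp M p \<Longrightarrow> (\<lambda>x. c * f x) \<in> Lp M p"
  by (auto simp: Lp_def norm_mult powr_mult)

lemma real_Lp_dominated_convergence:
  assumes "0 < p" "h \<in> real_Lp M p" "\<And>k. g k \<in> borel_measurable M"
    and "\<And>k. AE x in M. \<bar>g k x\<bar> \<le> \<bar>h x\<bar>" "AE x in M. (\<lambda>k. g k x) \<longlonglongrightarrow> 0"
  shows "(\<lambda>k. pth_power_integral M p (g k)) \<longlonglongrightarrow> 0"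
proof -
  note [measurable] = assms(3)
  have "(\<lambda>k. \<integral>x. \<bar>g k x\<bar> powr p \<partial>M) \<longlonglongrightarrow> (\<integral>x. 0 \<partial>M)"
  proof (rule integral_dominated_convergence[OF _ _ real_LpD[OF assms(2)]])
    show "AE x in M. (\<lambda>k. \<bar>g k x\<bar> powr p) \<longlonglongrightarrow> 0"
      using assms(5)
    proof eventually_elim
      case (elim x)
      then have "(\<lambda>k. \<bar>g k x\<bar>) \<longlonglongrightarrow> 0" by (simp add: tendsto_rabs_zero)
      then show ?case
        using tendsto_powr'[of "\<lambda>k. \<bar>g k x\<bar>" 0 sequentially "\<lambda>_. p" p] assms(1) by auto
    qed
    show "AE x in M. norm (\<bar>g k x\<bar> powr p) \<le> \<bar>h x\<bar> powr p" for k
      using assms(4)[of k] by eventually_elim (use assms(1) in \<open>auto intro: powr_mono2\<close>)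
  qed auto
  then show ?thesis by (simp add: pth_power_integral_def)
qed

text \<open>
  The norm of \<open>L\<^sup>p\<close> is a Levi norm for \<open>p < \<infinity>\<close>: by monotone convergence the supremum of the \<open>p\<close>-th
  powers has a finite integral, so it is finite almost everywhere, and its \<open>p\<close>-th root dominates the
  differences.
\<close>

lemma real_Lp_monotone_limit:
  assumes "0 < p" "\<And>n. a n \<in> real_Lp M p" "\<And>n. AE x in M. 0 \<le> a n x"
    and "\<And>n. AE x in M. a n x \<le> a (Suc n) x" "\<And>n. pth_power_integral M p (a n) \<le> B"
  obtains h where "h \<in> real_Lp M p" "\<And>n. AE x in M. a n x \<le> h x"
    "(\<lambda>n. pth_power_integral M p (\<lambda>x. h x - a n x)) \<longlonglongrightarrow> 0"
proof -
  note [measurable] = real_Lp_measurable[OF assms(2)]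
  have pos: "AE x in M. \<forall>n. 0 \<le> a n x" using assms(3) by (simp add: AE_all_countable)
  have mono: "AE x in M. \<forall>n. a n x \<le> a (Suc n) x" using assms(4) by (simp add: AE_all_countable)
  define F where "F = (\<lambda>n x. ennreal (\<bar>a n x\<bar> powr p))"
  have [measurable]: "F n \<in> borel_measurable M" for n by (simp add: F_def)
  have Fint: "(\<integral>\<^sup>+x. F n x \<partial>M) \<le> ennreal B" for n
    unfolding F_def
    by (subst nn_integral_eq_integral[OF real_LpD[OF assms(2)]])
       (use assms(5)[of n] in \<open>auto simp: pth_power_integral_def ennreal_leI\<close>)
  have Fmono: "AE x in M. \<forall>n. F n x \<le> F (Suc n) x"
    using pos mono unfolding F_def
    by eventually_elim (use assms(1) in \<open>auto intro!: ennreal_leI powr_mono2\<close>)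
  have "(\<integral>\<^sup>+x. (SUP n. F n x) \<partial>M) = (SUP n. \<integral>\<^sup>+x. F n x \<partial>M)"
    by (rule nn_integral_monotone_convergence_SUP_AE) (use Fmono in \<open>auto simp: AE_all_countable\<close>)
  also have "\<dots> \<le> ennreal B" by (rule SUP_least) (rule Fint)
  finally have intS: "(\<integral>\<^sup>+x. (SUP n. F n x) \<partial>M) \<le> ennreal B" .
  then have "(\<integral>\<^sup>+x. (SUP n. F n x) \<partial>M) \<noteq> \<infinity>" by (auto simp: top_unique)
  then have fin: "AE x in M. (SUP n. F n x) \<noteq> \<infinity>"
    by (intro nn_integral_PInf_AE) auto
  define h where "h = (\<lambda>x. lim (\<lambda>n. a n x))"
  have [measurable]: "h \<in> borel_measurable M" unfolding h_def by measurable
  have conv: "AE x in M. (\<lambda>n. a n x) \<longlonglongrightarrow> h x \<and> (\<forall>n. a n x \<le> h x)"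
    using pos mono fin
  proof eventually_elim
    case (elim x)
    have inc: "incseq (\<lambda>n. a n x)" using elim by (auto intro: incseq_SucI)
    obtain c where c: "0 \<le> c" "(SUP n. F n x) = ennreal c"
      using elim(3) by (cases "SUP n. F n x") auto
    have "a n x \<le> c powr (1/p)" for n
    proof -
      have "F n x \<le> ennreal c" unfolding c(2)[symmetric] by (rule SUP_upper) simp
      then have "\<bar>a n x\<bar> powr p \<le> c" using c(1) by (simp add: F_def)
      then have "(\<bar>a n x\<bar> powr p) powr (1/p) \<le> c powr (1/p)"
        using assms(1) by (intro powr_mono2) auto
      then show ?thesis using assms(1) by (simp add: powr_powr)
    qed
    then have "\<exists>l. (\<lambda>n. a n x) \<longlonglongrightarrow> l"
      using incseq_convergent[OF inc, of "c powr (1/p)"] by blast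
    then have "(\<lambda>n. a n x) \<longlonglongrightarrow> h x"
      unfolding h_def by (auto simp: convergent_LIMSEQ_iff[symmetric] convergent_def)
    with incseq_le[OF inc this] show ?case by auto
  qed
  have limF: "AE x in M. ennreal (\<bar>h x\<bar> powr p) \<le> (SUP n. F n x)"
    using conv
  proof eventually_elim
    case (elim x)
    have "(\<lambda>n. \<bar>a n x\<bar> powr p) \<longlonglongrightarrow> \<bar>h x\<bar> powr p"
      using elim assms(1) by (intro tendsto_powr' tendsto_rabs) auto
    then have "(\<lambda>n. F n x) \<longlonglongrightarrow> ennreal (\<bar>h x\<bar> powr p)"
      unfolding F_def by (intro tendsto_ennrealI)
    then show ?case by (rule LIMSEQ_le_const2) (intro exI[of _ 0] allI impI SUP_upper UNIV_I)
  qed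
  have "(\<integral>\<^sup>+x. ennreal (\<bar>h x\<bar> powr p) \<partial>M) \<le> ennreal B"
    using nn_integral_mono_AE[OF limF] intS by (rule order_trans)
  then have "integrable M (\<lambda>x. \<bar>h x\<bar> powr p)"
    by (intro integrableI_bounded) (auto simp: less_top[symmetric] top_unique)
  then have hL: "h \<in> real_Lp M p" by (simp add: real_Lp_def)
  have ah: "AE x in M. a n x \<le> h x" for n using conv by eventually_elim auto
  have "(\<lambda>n. pth_power_integral M p (\<lambda>x. h x - a n x)) \<longlonglongrightarrow> 0"
  proof (rule real_Lp_dominated_convergence[OF assms(1) hL])
    show "AE x in M. \<bar>h x - a n x\<bar> \<le> \<bar>h x\<bar>" for n
      using conv pos by eventually_elim (smt (verit))
    show "AE x in M. (\<lambda>n. h x - a n x) \<longlonglongrightarrow> 0"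
      using conv by eventually_elim (auto intro!: tendsto_eq_intros)
  qed auto
  with hL ah show ?thesis by (rule that)
qed

section \<open>Positive operators and their action on real functions\<close>

text \<open>
  A positive operator maps real functions to functions that are real almost everywhere; taking the
  real part chooses a representative that is real everywhere.
\<close>

definition real_restriction ::
    "(('a \<Rightarrow> complex) \<Rightarrow> ('a \<Rightarrow> complex)) \<Rightarrow> ('a \<Rightarrow> real) \<Rightarrow> 'a \<Rightarrow> real" where
  "real_restriction S g = (\<lambda>x. Re (S (\<lambda>y. complex_of_real (g y)) x))"

locale positive_Lp_operator =
  fixes M :: "'a measure" and p :: real and S :: "('a \<Rightarrow> complex) \<Rightarrow> ('a \<Rightarrow> complex)"
  assumes p_ge_1: "1 \<le> p"
    and linear: "Lp_linear_operator M p S"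
    and positive: "positive_operator M p S"
begin

abbreviation "R \<equiv> real_restriction S"

lemma p_pos: "0 < p" "0 \<le> p" using p_ge_1 by auto

lemma maps_Lp: "f \<in> Lp M p \<Longrightarrow> S f \<in> Lp M p"
  using linear by (simp add: Lp_linear_operator_def)

lemma cong_AE:
  "f \<in> Lp M p \<Longrightarrow> g \<in> Lp M p \<Longrightarrow> AE x in M. f x = g x \<Longrightarrow> AE x in M. S f x = S g x"
  using linear by (simp add: Lp_linear_operator_def ae_eq_def)

lemma add_AE:
  "f \<in> Lp M p \<Longrightarrow> g \<in> Lp M p \<Longrightarrow> AE x in M. S (\<lambda>x. f x + g x) x = S f x + S g x"
  using linear by (simp add: Lp_linear_operator_def ae_eq_def)

lemma cmult_AE: "f \<in> Lp M p \<Longrightarrow> AE x in M. S (\<lambda>x. c * f x) x = c * S f x"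
  using linear by (simp add: Lp_linear_operator_def ae_eq_def)

lemma R_in_real_Lp: "g \<in> real_Lp M p \<Longrightarrow> R g \<in> real_Lp M p"
  unfolding real_restriction_def
  by (intro Re_in_real_Lp maps_Lp p_pos) (simp add: of_real_in_Lp_iff)

lemma R_cong:
  assumes "g \<in> real_Lp M p" "h \<in> real_Lp M p" "AE x in M. g x = h x"
  shows "AE x in M. R g x = R h x"
proof -
  have "AE x in M. complex_of_real (g x) = complex_of_real (h x)"
    using assms(3) by simp
  from cong_AE[OF assms(1,2)[folded of_real_in_Lp_iff] this] show ?thesis
    by eventually_elim (simp add: real_restriction_def)
qed

lemma R_add:
  assumes "g \<in> real_Lp M p" "h \<in> real_Lp M p"
  shows "AE x in M. R (\<lambda>x. g x + h x) x = R g x + R h x"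
  using add_AE[OF assms[folded of_real_in_Lp_iff]]
  by eventually_elim (simp add: real_restriction_def)

lemma R_cmult:
  assumes "g \<in> real_Lp M p"
  shows "AE x in M. R (\<lambda>x. c * g x) x = c * R g x"
  using cmult_AE[OF assms[folded of_real_in_Lp_iff], of "of_real c"]
  by eventually_elim (simp add: real_restriction_def)

lemma R_diff:
  assumes "g \<in> real_Lp M p" "h \<in> real_Lp M p"
  shows "AE x in M. R (\<lambda>x. g x - h x) x = R g x - R h x"
  using R_add[OF assms(1) real_Lp_cmult(1)[OF assms(2), of "-1"]] R_cmult[OF assms(2), of "-1"]
  by eventually_elim simp

lemma S_nonneg_AE:
  assumes "g \<in> real_Lp M p" "AE x in M. 0 \<le> g x"
  shows "AE x in M. S (\<lambda>x. of_real (g x)) x \<in> \<real>\<^sub>\<ge>\<^sub>0"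
proof -
  have "ae_nonneg M (\<lambda>x. of_real (g x))"
    unfolding ae_nonneg_def using assms(2) by simp
  then show ?thesis
    using positive assms(1) by (simp add: positive_operator_def of_real_in_Lp_iff ae_nonneg_def)
qed

lemma R_nonneg:
  assumes "g \<in> real_Lp M p" "AE x in M. 0 \<le> g x"
  shows "AE x in M. 0 \<le> R g x"
  using S_nonneg_AE[OF assms]
  by eventually_elim (auto simp: real_restriction_def complex_nonneg_Reals_iff)

lemma R_mono:
  assumes "g \<in> real_Lp M p" "h \<in> real_Lp M p" "AE x in M. g x \<le> h x"
  shows "AE x in M. R g x \<le> R h x"
proof -
  have "AE x in M. 0 \<le> R (\<lambda>x. h x - g x) x"
    by (rule R_nonneg[OF real_Lp_diff]) (use assms p_pos in auto)
  then show ?thesis using R_diff[OF assms(2,1)] by eventually_elim simp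
qed

text \<open>Positive and negative part are mapped to nonnegative functions, so their difference is real.\<close>

lemma S_of_real:
  assumes "g \<in> real_Lp M p"
  shows "AE x in M. S (\<lambda>x. of_real (g x)) x = of_real (R g x)"
proof -
  have m [measurable]: "g \<in> borel_measurable M" using assms by (rule real_Lp_measurable)
  define gp where "gp = (\<lambda>x. max (g x) 0)"
  define gn where "gn = (\<lambda>x. max (- g x) 0)"
  have L: "gp \<in> real_Lp M p" "gn \<in> real_Lp M p"
    by (rule real_Lp_dominated(1)[OF p_pos(2) assms]; auto simp: gp_def gn_def)+
  have L2: "(\<lambda>x. (-1) * complex_of_real (gn x)) \<in> Lp M p"
    by (rule Lp_cmult) (use L in \<open>simp add: of_real_in_Lp_iff\<close>)
  have g: "(\<lambda>x. complex_of_real (g x)) = (\<lambda>x. of_real (gp x) + (-1) * of_real (gn x))"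
    by (auto simp: gp_def gn_def fun_eq_iff max_def)
  have "AE x in M. S (\<lambda>x. of_real (gp x)) x \<in> \<real>\<^sub>\<ge>\<^sub>0"
       "AE x in M. S (\<lambda>x. of_real (gn x)) x \<in> \<real>\<^sub>\<ge>\<^sub>0"
    by (rule S_nonneg_AE[OF L(1)] S_nonneg_AE[OF L(2)]; simp add: gp_def gn_def)+
  moreover have "AE x in M. S (\<lambda>x. of_real (g x)) x
      = S (\<lambda>x. of_real (gp x)) x + S (\<lambda>x. (-1) * of_real (gn x)) x"
    unfolding g by (rule add_AE) (use L L2 in \<open>simp_all add: of_real_in_Lp_iff\<close>)
  moreover have "AE x in M. S (\<lambda>x. (-1) * of_real (gn x)) x = (-1) * S (\<lambda>x. of_real (gn x)) x"
    by (rule cmult_AE) (use L in \<open>simp add: of_real_in_Lp_iff\<close>)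
  ultimately have "AE x in M. Im (S (\<lambda>x. of_real (g x)) x) = 0"
    by eventually_elim (simp add: complex_nonneg_Reals_iff)
  then show ?thesis
    by eventually_elim (simp add: real_restriction_def complex_eq_iff)
qed

lemma Re_S:
  assumes "f \<in> Lp M p"
  shows "AE x in M. Re (S f x) = R (\<lambda>x. Re (f x)) x"
proof -
  have L: "(\<lambda>x. complex_of_real (Re (f x))) \<in> Lp M p" "(\<lambda>x. complex_of_real (Im (f x))) \<in> Lp M p"
    using assms p_pos by (simp_all add: of_real_in_Lp_iff Re_in_real_Lp Im_in_real_Lp)
  have f: "f = (\<lambda>x. of_real (Re (f x)) + \<i> * of_real (Im (f x)))"
    by (simp add: complex_eq_iff fun_eq_iff)
  have "AE x in M. S f x = S (\<lambda>x. of_real (Re (f x))) x + S (\<lambda>x. \<i> * of_real (Im (f x))) x"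
    by (subst f, rule add_AE) (use L in \<open>auto intro: Lp_cmult\<close>)
  moreover note cmult_AE[OF L(2), of "\<i>"]
  moreover have "AE x in M. S (\<lambda>x. of_real (Re (f x))) x = of_real (R (\<lambda>x. Re (f x)) x)"
       "AE x in M. S (\<lambda>x. of_real (Im (f x))) x = of_real (R (\<lambda>x. Im (f x)) x)"
    by (rule S_of_real; use assms p_pos in \<open>simp add: Re_in_real_Lp Im_in_real_Lp\<close>)+
  ultimately show ?thesis by eventually_elim simp
qed

lemma R_Re_cmult_eigenfunction:
  assumes "f \<in> Lp M p" "AE x in M. S f x = \<nu> * f x"
  shows "AE x in M. R (\<lambda>x. Re (c * f x)) x = Re (c * \<nu> * f x)"
  using Re_S[OF Lp_cmult[OF assms(1), of c]] cmult_AE[OF assms(1), of c] assms(2)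
  by eventually_elim (simp add: mult.assoc)

end

lemma positive_Lp_operator_funpow:
  assumes "positive_Lp_operator M p T"
  shows "positive_Lp_operator M p (T ^^ n)"
proof (induction n)
  case 0
  show ?case using assms
    by (auto simp: positive_Lp_operator_def Lp_linear_operator_def positive_operator_def ae_eq_def)
next
  case (Suc n)
  interpret T: positive_Lp_operator M p T by fact
  interpret Tn: positive_Lp_operator M p "T ^^ n" by fact
  show ?case
  proof
    show "1 \<le> p" by (rule T.p_ge_1)
    show "Lp_linear_operator M p (T ^^ Suc n)"
      unfolding Lp_linear_operator_def ae_eq_def
    proof (intro conjI ballI allI impI)
      fix f assume f: "f \<in> Lp M p"
      then show "(T ^^ Suc n) f \<in> Lp M p" by (simp add: T.maps_Lp Tn.maps_Lp)
      show "AE x in M. (T ^^ Suc n) (\<lambda>x. c * f x) x = c * (T ^^ Suc n) f x" for c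
        using T.cong_AE[OF Tn.maps_Lp[OF Lp_cmult[OF f]] Lp_cmult[OF Tn.maps_Lp[OF f]]
            Tn.cmult_AE[OF f, of c]] T.cmult_AE[OF Tn.maps_Lp[OF f], of c]
        by eventually_elim simp
      fix g assume g: "g \<in> Lp M p"
      show "AE x in M. (T ^^ Suc n) f x = (T ^^ Suc n) g x" if "AE x in M. f x = g x"
        using T.cong_AE[OF _ _ Tn.cong_AE[OF f g that]] Tn.maps_Lp f g by simp
      show "AE x in M. (T ^^ Suc n) (\<lambda>x. f x + g x) x = (T ^^ Suc n) f x + (T ^^ Suc n) g x"
        using T.cong_AE[OF Tn.maps_Lp[OF Lp_add[OF T.p_pos(2) f g]]
            Lp_add[OF T.p_pos(2) Tn.maps_Lp[OF f] Tn.maps_Lp[OF g]] Tn.add_AE[OF f g]]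
          T.add_AE[OF Tn.maps_Lp[OF f] Tn.maps_Lp[OF g]]
        by eventually_elim simp
    qed
    show "positive_operator M p (T ^^ Suc n)"
      using T.positive Tn.positive Tn.maps_Lp by (simp add: positive_operator_def)
  qed
qed

section \<open>Eigenfunctions\<close>

lemma dense_in_circle:
  obtains D :: "complex set" where "countable D" "\<And>\<theta>. \<theta> \<in> D \<Longrightarrow> norm \<theta> = 1"
    "\<And>z. norm z = 1 \<Longrightarrow> \<exists>\<theta>. (\<forall>k. \<theta> k \<in> D) \<and> \<theta> \<longlonglongrightarrow> z"
proof -
  obtain D where D: "countable D" "D \<subseteq> sphere (0::complex) 1" "sphere (0::complex) 1 \<subseteq> closure D"
    using separable by blast
  show ?thesis
  proof
    show "\<exists>\<theta>. (\<forall>k. \<theta> k \<in> D) \<and> \<theta> \<longlonglongrightarrow> z" if "norm z = 1" for z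
      using D(3) that closure_sequential[of z D] by auto
  qed (use D in auto)
qed

context positive_Lp_operator
begin

text \<open>
  The modulus is the supremum of \<open>Re (\<theta> f)\<close> over the unit circle. A countable dense set of \<open>\<theta>\<close> is
  enough, so the exceptional null sets can be collected into one.
\<close>

lemma norm_eigenfunction_le:
  assumes f: "f \<in> Lp M p" and ev: "AE x in M. S f x = \<nu> * f x" and "norm \<nu> = 1"
  shows "AE x in M. norm (f x) \<le> R (\<lambda>x. norm (f x)) x"
proof -
  obtain D :: "complex set" where D: "countable D" "\<And>\<theta>. \<theta> \<in> D \<Longrightarrow> norm \<theta> = 1"
    "\<And>z. norm z = 1 \<Longrightarrow> \<exists>\<theta>. (\<forall>k. \<theta> k \<in> D) \<and> \<theta> \<longlonglongrightarrow> z"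
    using dense_in_circle by blast
  have "AE x in M. Re (\<theta> * \<nu> * f x) \<le> R (\<lambda>x. norm (f x)) x" if "\<theta> \<in> D" for \<theta>
  proof -
    have reL: "(\<lambda>x. Re (\<theta> * f x)) \<in> real_Lp M p"
      by (rule Re_in_real_Lp[OF p_pos(2) Lp_cmult[OF f]])
    have "AE x in M. R (\<lambda>x. Re (\<theta> * f x)) x \<le> R (\<lambda>x. norm (f x)) x"
    proof (rule R_mono)
      have "Re (\<theta> * f x) \<le> norm (f x)" for x
        using complex_Re_le_cmod[of "\<theta> * f x"] D(2)[OF that] by (simp add: norm_mult)
      then show "AE x in M. Re (\<theta> * f x) \<le> norm (f x)" by simp
    qed (rule reL norm_in_real_Lp[OF f])+
    then show ?thesis
      using R_Re_cmult_eigenfunction[OF f ev, of \<theta>] by eventually_elim simp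
  qed
  then have "AE x in M. \<forall>\<theta>\<in>D. Re (\<theta> * \<nu> * f x) \<le> R (\<lambda>x. norm (f x)) x"
    using D(1) by (simp add: AE_ball_countable)
  moreover have "AE x in M. 0 \<le> R (\<lambda>x. norm (f x)) x"
    by (rule R_nonneg) (use f in \<open>auto intro: norm_in_real_Lp\<close>)
  ultimately show ?thesis
  proof eventually_elim
    case (elim x)
    show ?case
    proof (cases "f x = 0")
      case False
      define z where "z = cnj (\<nu> * f x) / norm (f x)"
      have nz: "norm z = 1" using False assms(3) by (simp add: z_def norm_divide norm_mult)
      have "z * \<nu> * f x = (\<nu> * f x) * cnj (\<nu> * f x) / norm (f x)"
        by (simp add: z_def mult_ac)
      also have "\<dots> = norm (\<nu> * f x) ^ 2 / norm (f x)"
        by (simp only: complex_norm_square of_real_divide)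
      finally have "z * \<nu> * f x = norm (\<nu> * f x) ^ 2 / norm (f x)" .
      then have zf: "z * \<nu> * f x = of_real (norm (f x))"
        using False assms(3) by (simp add: norm_mult power2_eq_square)
      obtain \<theta> where \<theta>: "\<And>k. \<theta> k \<in> D" "\<theta> \<longlonglongrightarrow> z" using D(3)[OF nz] by blast
      have "(\<lambda>k. Re (\<theta> k * \<nu> * f x)) \<longlonglongrightarrow> Re (z * \<nu> * f x)"
        by (intro tendsto_intros \<theta>)
      then have "Re (z * \<nu> * f x) \<le> R (\<lambda>x. norm (f x)) x"
        by (rule LIMSEQ_le_const2) (use elim \<theta>(1) in auto)
      then show ?thesis by (simp add: zf)
    qed (use elim in simp)
  qed
qed

text \<open>
  If \<open>g\<close> lives where \<open>f / h\<close> is within \<open>r\<close> of \<open>\<zeta>\<close>, then there \<open>f / h\<close> has distance at least \<open>r\<close> from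
  each \<open>\<theta>\<close> with \<open>|\<theta> - \<zeta>| \<ge> 2r\<close>, and so \<open>g\<close> is dominated by a multiple of \<open>h - Re (cnj \<theta> * f)\<close>
  with a constant independent of \<open>\<theta>\<close>. Applying \<open>S\<close> bounds \<open>S g\<close> by the same multiple of
  \<open>h - Re (cnj \<theta> * \<nu> f)\<close>. Where \<open>|f| = h\<close>, this bound tends to \<open>0\<close> as \<open>\<theta>\<close> approaches \<open>\<nu> f / h\<close>,
  which is possible as soon as \<open>\<nu> f / h\<close> has distance more than \<open>2r\<close> from \<open>\<zeta>\<close>.
\<close>

lemma localisation:
  fixes \<zeta> :: complex
  assumes f: "f \<in> Lp M p" and ev: "AE x in M. S f x = \<nu> * f x" and \<nu>: "norm \<nu> = 1"
    and h: "h \<in> real_Lp M p" and fixed: "AE x in M. R h x = h x"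
    and fh: "AE x in M. norm (f x) \<le> h x"
    and g: "g \<in> real_Lp M p" and g0: "AE x in M. 0 \<le> g x" and gh: "AE x in M. g x \<le> h x"
    and "0 < r" and supp: "AE x in M. g x \<noteq> 0 \<longrightarrow> norm (f x - \<zeta> * h x) < r * h x"
  shows "AE x in M. norm (f x) = h x \<and> R g x \<noteq> 0 \<longrightarrow> norm (\<nu> * f x - \<zeta> * h x) \<le> 2 * r * h x"
proof -
  obtain D :: "complex set" where D: "countable D" "\<And>\<theta>. \<theta> \<in> D \<Longrightarrow> norm \<theta> = 1"
    "\<And>z. norm z = 1 \<Longrightarrow> \<exists>\<theta>. (\<forall>k. \<theta> k \<in> D) \<and> \<theta> \<longlonglongrightarrow> z"
    using dense_in_circle by blast
  have "AE x in M. norm (\<theta> - \<zeta>) \<ge> 2 * r \<longrightarrow> R g x \<le> 2 / r\<^sup>2 * (h x - Re (cnj \<theta> * \<nu> * f x))"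
    if \<theta>: "\<theta> \<in> D" for \<theta>
  proof (cases "norm (\<theta> - \<zeta>) \<ge> 2 * r")
    case far: True
    have reL: "(\<lambda>x. Re (cnj \<theta> * f x)) \<in> real_Lp M p"
      by (rule Re_in_real_Lp[OF p_pos(2) Lp_cmult[OF f]])
    note wL = real_Lp_diff[OF p_pos(2) h reL]
    \<comment> \<open>Where \<open>g\<close> is nonzero, \<open>u = f / h\<close> satisfies \<open>r\<^sup>2 \<le> |u - \<theta>|\<^sup>2 \<le> 2 (1 - Re (cnj \<theta> * u))\<close>.\<close>
    have "AE x in M. g x \<le> 2 / r\<^sup>2 * (h x - Re (cnj \<theta> * f x))"
      using fh gh supp
    proof eventually_elim
      case (elim x)
      have Re_le: "Re (cnj \<theta> * f x) \<le> norm (f x)"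
        using complex_Re_le_cmod[of "cnj \<theta> * f x"] D(2)[OF \<theta>] by (simp add: norm_mult)
      show ?case
      proof (cases "g x = 0")
        case True
        then show ?thesis using Re_le elim by simp
      next
        case False
        then have near: "norm (f x - \<zeta> * h x) < r * h x" using elim by simp
        have "0 < r * h x" by (rule le_less_trans[OF norm_ge_zero near])
        then have h0: "0 < h x" using \<open>0 < r\<close> by (simp add: zero_less_mult_iff)
        have "(2 * r) * h x \<le> norm (\<theta> - \<zeta>) * h x"
          using far h0 by (intro mult_right_mono) auto
        also have "\<dots> = norm (\<theta> * h x - \<zeta> * h x)"
          using h0 by (simp add: norm_mult flip: left_diff_distrib)
        also have "\<dots> \<le> norm (f x - \<zeta> * h x) + norm (f x - \<theta> * h x)"
          using norm_triangle_ineq4[of "f x - \<zeta> * h x" "f x - \<theta> * h x"] by simp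
        finally have "r * h x \<le> norm (f x - \<theta> * h x)" using near by simp
        then have "(r * h x)\<^sup>2 \<le> (norm (f x - \<theta> * h x))\<^sup>2"
          using \<open>0 < r * h x\<close> by (intro power_mono) auto
        also have "\<dots> = (norm (f x))\<^sup>2 + (norm \<theta>)\<^sup>2 * (h x)\<^sup>2 - 2 * h x * Re (cnj \<theta> * f x)"
          unfolding cmod_power2 by (simp add: power2_eq_square algebra_simps)
        also have "\<dots> \<le> (h x)\<^sup>2 + (h x)\<^sup>2 - 2 * h x * Re (cnj \<theta> * f x)"
          using D(2)[OF \<theta>] elim by (simp add: power_mono)
        finally have "h x * (r\<^sup>2 * h x) \<le> h x * (2 * (h x - Re (cnj \<theta> * f x)))"
          by (simp add: power2_eq_square algebra_simps)
        then have "r\<^sup>2 * h x \<le> 2 * (h x - Re (cnj \<theta> * f x))"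
          using h0 by simp
        then have "h x \<le> 2 / r\<^sup>2 * (h x - Re (cnj \<theta> * f x))"
          using \<open>0 < r\<close> by (simp add: field_simps)
        then show ?thesis using elim by simp
      qed
    qed
    then have "AE x in M. R g x \<le> R (\<lambda>x. 2 / r\<^sup>2 * (h x - Re (cnj \<theta> * f x))) x"
      by (rule R_mono[OF g real_Lp_cmult(1)[OF wL]])
    then show ?thesis
      using R_cmult[OF wL, of "2 / r\<^sup>2"] R_diff[OF h reL] fixed
        R_Re_cmult_eigenfunction[OF f ev, of "cnj \<theta>"]
      by eventually_elim simp
  qed simp
  then have "AE x in M. \<forall>\<theta>\<in>D. norm (\<theta> - \<zeta>) \<ge> 2 * r \<longrightarrow>
      R g x \<le> 2 / r\<^sup>2 * (h x - Re (cnj \<theta> * \<nu> * f x))"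
    using D(1) by (simp add: AE_ball_countable)
  then show ?thesis using fh R_nonneg[OF g g0]
  proof eventually_elim
    case (elim x)
    show ?case
    proof (rule impI, rule ccontr)
      assume *: "norm (f x) = h x \<and> R g x \<noteq> 0"
        and "\<not> norm (\<nu> * f x - \<zeta> * h x) \<le> 2 * r * h x"
      then have far: "2 * r * h x < norm (\<nu> * f x - \<zeta> * h x)" by simp
      have h0: "h x > 0"
      proof (rule ccontr)
        assume "\<not> h x > 0"
        with * have "h x = 0" using norm_ge_zero[of "f x"] by linarith
        moreover from this * have "f x = 0" by simp
        ultimately show False using far by simp
      qed
      define z where "z = \<nu> * f x / h x"
      have nz: "norm z = 1" using * h0 \<nu> by (simp add: z_def norm_divide norm_mult)
      have zh: "\<nu> * f x = z * h x" using h0 by (simp add: z_def)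
      have "2 * r * h x < norm (z - \<zeta>) * h x"
        using far h0 unfolding zh by (simp add: norm_mult flip: left_diff_distrib)
      then have "2 * r < norm (z - \<zeta>)" using h0 by simp
      obtain \<theta> where \<theta>: "\<And>k. \<theta> k \<in> D" "\<theta> \<longlonglongrightarrow> z" using D(3)[OF nz] by blast
      have "(\<lambda>k. norm (\<theta> k - \<zeta>)) \<longlonglongrightarrow> norm (z - \<zeta>)" by (intro tendsto_intros \<theta>)
      then have ev: "eventually (\<lambda>k. 2 * r < norm (\<theta> k - \<zeta>)) sequentially"
        using \<open>2 * r < norm (z - \<zeta>)\<close> by (rule order_tendstoD)
      have "(\<lambda>k. 2 / r\<^sup>2 * (h x - Re (cnj (\<theta> k) * \<nu> * f x)))
          \<longlonglongrightarrow> 2 / r\<^sup>2 * (h x - Re (cnj z * \<nu> * f x))"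
        by (intro tendsto_intros \<theta>)
      moreover have "cnj z * \<nu> * f x = of_real (h x)"
      proof -
        have "cnj z * \<nu> * f x = z * cnj z * h x" using zh by (simp add: mult_ac)
        also have "z * cnj z = 1" using nz complex_norm_square[of z] by simp
        finally show ?thesis by simp
      qed
      ultimately have lim: "(\<lambda>k. 2 / r\<^sup>2 * (h x - Re (cnj (\<theta> k) * \<nu> * f x))) \<longlonglongrightarrow> 0" by simp
      have "eventually (\<lambda>k. R g x \<le> 2 / r\<^sup>2 * (h x - Re (cnj (\<theta> k) * \<nu> * f x))) sequentially"
        using ev by eventually_elim (use elim(1) \<theta>(1) in auto)
      with lim have "R g x \<le> 0"
        by (rule tendsto_lowerbound) simp
      with * elim(3) show False by simp
    qed
  qed
qed

end

section \<open>Power bounded positive operators\<close>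

text \<open>
  The operator norm is a supremum over the unit ball; a function of nonzero norm is rescaled into it,
  with \<open>s\<close> below being the reciprocal of the norm.
\<close>

lemma power_bounded_pth_power_integral:
  assumes "1 \<le> p" and pow: "\<And>n. positive_Lp_operator M p (T ^^ n)" and "power_bounded M p T"
  obtains K where
    "\<And>n f. f \<in> Lp M p \<Longrightarrow> pth_power_integral M p (\<lambda>x. norm ((T ^^ n) f x))
       \<le> K * pth_power_integral M p (\<lambda>x. norm (f x))"
proof -
  have p: "0 < p" using assms(1) by simp
  have norm_eq: "Lp_norm M p f = pth_power_integral M p (\<lambda>x. norm (f x)) powr (1 / p)" for f
    by (simp add: Lp_norm_def pth_power_integral_def)
  obtain c where c: "0 \<le> c" "(SUP n. operator_norm M p (T ^^ n)) = ennreal c"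
    using assms(3) unfolding power_bounded_def
    by (cases "SUP n. operator_norm M p (T ^^ n)") auto
  have bound: "Lp_norm M p ((T ^^ n) f) \<le> c" if "f \<in> Lp M p" "Lp_norm M p f \<le> 1" for n f
  proof -
    have "ennreal (Lp_norm M p ((T ^^ n) f)) \<le> operator_norm M p (T ^^ n)"
      unfolding operator_norm_def by (rule SUP_upper) (use that in auto)
    also have "\<dots> \<le> ennreal c" unfolding c(2)[symmetric] by (rule SUP_upper) simp
    finally show ?thesis using c(1) by simp
  qed
  show ?thesis
  proof
    fix n f assume f: "f \<in> Lp M p"
    interpret Tn: positive_Lp_operator M p "T ^^ n" by (rule pow)
    let ?I = "\<lambda>f. pth_power_integral M p (\<lambda>x. norm (f x :: complex))"
    have scale: "?I (\<lambda>x. of_real s * f x) = \<bar>s\<bar> powr p * ?I f"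
      if "f \<in> Lp M p" for s and f :: "'a \<Rightarrow> complex"
      using real_Lp_cmult(2)[OF norm_in_real_Lp[OF that], of "\<bar>s\<bar>"] by (simp add: norm_mult)
    show "?I ((T ^^ n) f) \<le> c powr p * ?I f"
    proof (cases "?I f = 0")
      case True
      then have "AE x in M. f x = 0"
        using pth_power_integral_eq_0D[OF norm_in_real_Lp[OF f]] by simp
      then have "AE x in M. f x = 0 * f x" by simp
      from Tn.cong_AE[OF f Lp_cmult[OF f] this] Tn.cmult_AE[OF f, of 0]
      have "AE x in M. norm ((T ^^ n) f x) = norm (f x)"
        using \<open>AE x in M. f x = 0\<close> by eventually_elim simp
      then have "?I ((T ^^ n) f) = ?I f"
        by (rule pth_power_integral_cong[OF norm_in_real_Lp[OF Tn.maps_Lp[OF f]] norm_in_real_Lp[OF f]])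
      with True show ?thesis by simp
    next
      case False
      then have I: "0 < ?I f" using pth_power_integral_nonneg[of M p "\<lambda>x. norm (f x)"] by simp
      define s where "s = ?I f powr (- 1 / p)"
      have s: "0 < s" using I by (simp add: s_def)
      have sp: "s powr p = inverse (?I f)"
        using I p unfolding s_def powr_powr by (simp add: powr_minus)
      let ?g = "\<lambda>x. of_real s * f x"
      have "?I ?g = 1" using scale[OF f, of s] s sp I by simp
      then have "Lp_norm M p ((T ^^ n) ?g) \<le> c"
        by (intro bound Lp_cmult f) (simp add: norm_eq)
      then have "(?I ((T ^^ n) ?g) powr (1 / p)) powr p \<le> c powr p"
        unfolding norm_eq using p by (intro powr_mono2) auto
      then have "?I ((T ^^ n) ?g) \<le> c powr p"
        using p pth_power_integral_nonneg by (simp add: powr_powr)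
      moreover have "?I ((T ^^ n) ?g) = ?I (\<lambda>x. of_real s * (T ^^ n) f x)"
        by (rule pth_power_integral_cong[OF norm_in_real_Lp[OF Tn.maps_Lp[OF Lp_cmult[OF f]]]
              norm_in_real_Lp[OF Lp_cmult[OF Tn.maps_Lp[OF f]]]])
           (use Tn.cmult_AE[OF f, of "of_real s"] in \<open>eventually_elim, simp\<close>)
      ultimately have "inverse (?I f) * ?I ((T ^^ n) f) \<le> c powr p"
        using scale[OF Tn.maps_Lp[OF f], of s] s sp by simp
      then show ?thesis using I by (simp add: field_simps)
    qed
  qed
qed

locale power_bounded_positive_operator = positive_Lp_operator M p T
  for M :: "'a measure" and p :: real and T :: "('a \<Rightarrow> complex) \<Rightarrow> ('a \<Rightarrow> complex)" +
  fixes K :: real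
  assumes powers_bounded: "\<And>n f. f \<in> Lp M p \<Longrightarrow> pth_power_integral M p (\<lambda>x. norm ((T ^^ n) f x))
       \<le> K * pth_power_integral M p (\<lambda>x. norm (f x))"
begin

sublocale pow: positive_Lp_operator M p "T ^^ n" for n
  by (rule positive_Lp_operator_funpow[OF positive_Lp_operator_axioms])

abbreviation Rn :: "nat \<Rightarrow> ('a \<Rightarrow> real) \<Rightarrow> 'a \<Rightarrow> real" where
  "Rn n \<equiv> real_restriction (T ^^ n)"

abbreviation I :: "('a \<Rightarrow> real) \<Rightarrow> real" where
  "I \<equiv> pth_power_integral M p"

lemma Rn_0: "Rn 0 g = g" and Rn_1: "Rn 1 g = R g"
  by (simp_all add: real_restriction_def)

lemma Rn_bounded:
  assumes "g \<in> real_Lp M p"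
  shows "I (Rn n g) \<le> K * I g"
proof -
  have L: "(\<lambda>x. complex_of_real (g x)) \<in> Lp M p" using assms by (simp add: of_real_in_Lp_iff)
  have "I (Rn n g) \<le> I (\<lambda>x. norm ((T ^^ n) (\<lambda>x. complex_of_real (g x)) x))"
    by (rule real_Lp_dominated(2)[OF p_pos(2) norm_in_real_Lp[OF pow.maps_Lp[OF L]]
          real_Lp_measurable[OF pow.R_in_real_Lp[OF assms]]])
       (simp add: real_restriction_def abs_Re_le_cmod)
  also have "\<dots> \<le> K * I (\<lambda>x. norm (complex_of_real (g x)))"
    by (rule powers_bounded[OF L])
  also have "I (\<lambda>x. norm (complex_of_real (g x))) = I g"
    by (simp add: pth_power_integral_def)
  finally show ?thesis .
qed

lemma Rn_add_exponent:
  assumes "g \<in> real_Lp M p"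
  shows "AE x in M. Rn (m + n) g x = Rn m (Rn n g) x"
proof -
  have L: "(\<lambda>x. complex_of_real (g x)) \<in> Lp M p" using assms by (simp add: of_real_in_Lp_iff)
  have L': "(\<lambda>x. complex_of_real (Rn n g x)) \<in> Lp M p"
    using pow.R_in_real_Lp[OF assms] by (simp add: of_real_in_Lp_iff)
  from pow.cong_AE[OF pow.maps_Lp[OF L] L' pow.S_of_real[OF assms], of m]
  show ?thesis
    by eventually_elim (simp add: real_restriction_def funpow_add)
qed

lemma Rn_Suc:
  assumes "g \<in> real_Lp M p"
  shows "AE x in M. Rn (Suc n) g x = R (Rn n g) x"
    and "AE x in M. Rn (Suc n) g x = Rn n (R g) x"
  using Rn_add_exponent[OF assms, of 1 n] Rn_add_exponent[OF assms, of n 1]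
  unfolding Rn_1 by (simp_all only: add_Suc_right add_Suc add_0 add_0_right One_nat_def)

lemma eigenfunction_funpow:
  assumes "f \<in> Lp M p" "AE x in M. T f x = \<nu> * f x"
  shows "AE x in M. (T ^^ n) f x = \<nu> ^ n * f x"
proof (induction n)
  case (Suc n)
  from cong_AE[OF pow.maps_Lp[OF assms(1)] Lp_cmult[OF assms(1)] Suc]
    cmult_AE[OF assms(1), of "\<nu> ^ n"] assms(2)
  show ?case by eventually_elim simp
qed simp

lemma fixed_funpow:
  assumes "h \<in> real_Lp M p" "AE x in M. R h x = h x"
  shows "AE x in M. Rn n h x = h x"
proof (induction n)
  case 0
  show ?case by (simp add: real_restriction_def)
next
  case (Suc n)
  from Rn_Suc(1)[OF assms(1), of n] R_cong[OF pow.R_in_real_Lp[OF assms(1)] assms(1) Suc] assms(2)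
  show ?case by eventually_elim (simp only:)
qed

section \<open>The ideal of functions with vanishing orbit\<close>

text \<open>
  Restricted to nonnegative functions, this is membership in the ideal \<open>J\<close>.
\<close>

definition vanishing :: "('a \<Rightarrow> real) \<Rightarrow> bool" where
  "vanishing g \<longleftrightarrow> g \<in> real_Lp M p \<and> (\<lambda>n. I (Rn n g)) \<longlonglongrightarrow> 0"

lemma vanishing_real_Lp: "vanishing g \<Longrightarrow> g \<in> real_Lp M p"
  by (simp add: vanishing_def)

lemma vanishing_add:
  assumes "vanishing g" "vanishing h"
  shows "vanishing (\<lambda>x. g x + h x)"
  unfolding vanishing_def
proof
  note L = vanishing_real_Lp[OF assms(1)] vanishing_real_Lp[OF assms(2)]
  show sumL: "(\<lambda>x. g x + h x) \<in> real_Lp M p" by (rule real_Lp_add(1)[OF p_pos(2) L])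
  have "I (Rn n (\<lambda>x. g x + h x)) \<le> 2 powr p * (I (Rn n g) + I (Rn n h))" for n
  proof -
    have "I (Rn n (\<lambda>x. g x + h x)) = I (\<lambda>x. Rn n g x + Rn n h x)"
      by (intro pth_power_integral_cong pow.R_in_real_Lp sumL pow.R_add L real_Lp_add(1) p_pos)
    also have "\<dots> \<le> 2 powr p * (I (Rn n g) + I (Rn n h))"
      by (intro real_Lp_add(2) p_pos pow.R_in_real_Lp L)
    finally show ?thesis .
  qed
  moreover have "(\<lambda>n. 2 powr p * (I (Rn n g) + I (Rn n h))) \<longlonglongrightarrow> 2 powr p * (0 + 0)"
    using assms unfolding vanishing_def by (intro tendsto_intros) auto
  ultimately show "(\<lambda>n. I (Rn n (\<lambda>x. g x + h x))) \<longlonglongrightarrow> 0"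
    using Lim_null_comparison[where f = "\<lambda>n. I (Rn n (\<lambda>x. g x + h x))"
        and g = "\<lambda>n. 2 powr p * (I (Rn n g) + I (Rn n h))"]
    by (simp only: real_norm_def abs_of_nonneg[OF pth_power_integral_nonneg] eventually_True
        add_0_left mult_zero_right)
qed

lemma vanishing_cmult:
  assumes "vanishing g"
  shows "vanishing (\<lambda>x. c * g x)"
  unfolding vanishing_def
proof
  note L = vanishing_real_Lp[OF assms]
  show cL: "(\<lambda>x. c * g x) \<in> real_Lp M p" by (rule real_Lp_cmult(1)[OF L])
  have "I (Rn n (\<lambda>x. c * g x)) = \<bar>c\<bar> powr p * I (Rn n g)" for n
    using pth_power_integral_cong[OF pow.R_in_real_Lp[OF cL]
        real_Lp_cmult(1)[OF pow.R_in_real_Lp[OF L]] pow.R_cmult[OF L]]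
    by (simp add: real_Lp_cmult(2)[OF pow.R_in_real_Lp[OF L]])
  moreover have "(\<lambda>n. \<bar>c\<bar> powr p * I (Rn n g)) \<longlonglongrightarrow> \<bar>c\<bar> powr p * 0"
    using assms unfolding vanishing_def by (intro tendsto_intros) auto
  ultimately show "(\<lambda>n. I (Rn n (\<lambda>x. c * g x))) \<longlonglongrightarrow> 0" by simp
qed

lemma vanishing_zero: "vanishing (\<lambda>x. 0)"
proof -
  have "(\<lambda>x. 0) \<in> real_Lp M p" by (simp add: real_Lp_def)
  then have "I (Rn n (\<lambda>x. 0)) = 0" for n
    using Rn_bounded[of "\<lambda>x. 0" n] pth_power_integral_nonneg[of M p "Rn n (\<lambda>x. 0)"]
    by (simp add: pth_power_integral_def[of M p "\<lambda>x. 0"])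
  then show ?thesis using \<open>(\<lambda>x. 0) \<in> real_Lp M p\<close> by (simp add: vanishing_def)
qed

lemma vanishing_sum:
  assumes "finite Z" "\<And>z. z \<in> Z \<Longrightarrow> vanishing (g z)"
  shows "vanishing (\<lambda>x. \<Sum>z\<in>Z. g z x)"
  using assms by (induction Z rule: finite_induct) (auto intro: vanishing_zero vanishing_add)

lemma vanishing_dominated:
  assumes "vanishing h" "g \<in> real_Lp M p" "AE x in M. 0 \<le> g x" "AE x in M. g x \<le> h x"
  shows "vanishing g"
  unfolding vanishing_def
proof
  note hL = vanishing_real_Lp[OF assms(1)]
  have "I (Rn n g) \<le> I (Rn n h)" for n
  proof (rule real_Lp_dominated(2)[OF p_pos(2) pow.R_in_real_Lp[OF hL]
          real_Lp_measurable[OF pow.R_in_real_Lp[OF assms(2)]]])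
    show "AE x in M. \<bar>Rn n g x\<bar> \<le> \<bar>Rn n h x\<bar>"
      using pow.R_nonneg[OF assms(2,3), of n] pow.R_mono[OF assms(2) hL assms(4), of n]
      by eventually_elim simp
  qed
  then show "(\<lambda>n. I (Rn n g)) \<longlonglongrightarrow> 0"
    using Lim_null_comparison[where f = "\<lambda>n. I (Rn n g)" and g = "\<lambda>n. I (Rn n h)"] assms(1)
    by (simp add: vanishing_def pth_power_integral_nonneg)
qed (rule assms)

text \<open>
  Power boundedness makes the approximation error uniform along the orbit, hence limits in norm
  inherit the property.
\<close>

lemma vanishing_closed:
  assumes g: "g \<in> real_Lp M p" and "\<And>k. vanishing (a k)"
    and "(\<lambda>k. I (\<lambda>x. g x - a k x)) \<longlonglongrightarrow> 0"
  shows "vanishing g"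
  unfolding vanishing_def
proof
  note aL = vanishing_real_Lp[OF assms(2)]
  have bound: "I (Rn n g) \<le> 2 powr p * (I (Rn n (a k)) + K * I (\<lambda>x. g x - a k x))" for n k
  proof -
    note dL = real_Lp_diff[OF p_pos(2) g aL[of k]]
    have "AE x in M. Rn n g x = Rn n (a k) x + Rn n (\<lambda>x. g x - a k x) x"
      using pow.R_diff[OF g aL[of k], of n] by eventually_elim simp
    then have "I (Rn n g) = I (\<lambda>x. Rn n (a k) x + Rn n (\<lambda>x. g x - a k x) x)"
      by (intro pth_power_integral_cong pow.R_in_real_Lp g real_Lp_add(1) p_pos aL dL)
    also have "\<dots> \<le> 2 powr p * (I (Rn n (a k)) + I (Rn n (\<lambda>x. g x - a k x)))"
      by (intro real_Lp_add(2) p_pos pow.R_in_real_Lp aL dL)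
    also have "\<dots> \<le> 2 powr p * (I (Rn n (a k)) + K * I (\<lambda>x. g x - a k x))"
      by (intro mult_left_mono add_left_mono Rn_bounded dL) simp
    finally show ?thesis .
  qed
  show "(\<lambda>n. I (Rn n g)) \<longlonglongrightarrow> 0"
  proof (rule order_tendstoI)
    show "eventually (\<lambda>n. b < I (Rn n g)) sequentially" if "b < 0" for b
      using that pth_power_integral_nonneg by (intro always_eventually allI) (rule less_le_trans)
    fix e :: real assume "0 < e"
    have "(\<lambda>k. 2 powr p * (0 + K * I (\<lambda>x. g x - a k x))) \<longlonglongrightarrow> 2 powr p * (0 + K * 0)"
      by (intro tendsto_intros assms(3))
    then have "eventually (\<lambda>k. 2 powr p * (0 + K * I (\<lambda>x. g x - a k x)) < e) sequentially"
      using \<open>0 < e\<close> by (intro order_tendstoD(2)) auto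
    then obtain k where k: "2 powr p * (0 + K * I (\<lambda>x. g x - a k x)) < e"
      by (auto simp: eventually_sequentially)
    have "(\<lambda>n. 2 powr p * (I (Rn n (a k)) + K * I (\<lambda>x. g x - a k x)))
        \<longlonglongrightarrow> 2 powr p * (0 + K * I (\<lambda>x. g x - a k x))"
      using assms(2)[of k] unfolding vanishing_def by (intro tendsto_intros) auto
    then have "eventually (\<lambda>n. 2 powr p * (I (Rn n (a k)) + K * I (\<lambda>x. g x - a k x)) < e) sequentially"
      using k by (rule order_tendstoD(2))
    then show "eventually (\<lambda>n. I (Rn n g) < e) sequentially"
      by eventually_elim (rule le_less_trans[OF bound])
  qed
qed (rule g)

text \<open>Where \<open>w > 0\<close>, the multiples \<open>k w\<close> exceed \<open>g\<close> eventually, so \<open>g\<close> is the norm limit of the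
  functions \<open>min g (k w)\<close>, each of which is dominated by a multiple of \<open>w\<close>.\<close>

lemma vanishing_band:
  assumes "vanishing w" "AE x in M. 0 \<le> w x" and g: "g \<in> real_Lp M p" and "AE x in M. 0 \<le> g x"
    and "AE x in M. g x \<noteq> 0 \<longrightarrow> w x \<noteq> 0"
  shows "vanishing g"
proof -
  note wL = vanishing_real_Lp[OF assms(1)]
  note [measurable] = real_Lp_measurable[OF g] real_Lp_measurable[OF wL]
  let ?a = "\<lambda>k x. min (g x) (real k * w x)"
  have "vanishing (?a k)" for k
  proof (rule vanishing_dominated[OF vanishing_cmult[OF assms(1)]])
    show "?a k \<in> real_Lp M p"
      by (rule real_Lp_dominated(1)[OF p_pos(2) g])
         (measurable, use assms(2,4) in \<open>eventually_elim, simp\<close>)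
    show "AE x in M. 0 \<le> ?a k x" using assms(2,4) by eventually_elim simp
    show "AE x in M. ?a k x \<le> real k * w x" by simp
  qed
  then show ?thesis
  proof (rule vanishing_closed[OF g])
    show "(\<lambda>k. I (\<lambda>x. g x - ?a k x)) \<longlonglongrightarrow> 0"
    proof (rule real_Lp_dominated_convergence[OF p_pos(1) g])
      show "AE x in M. \<bar>g x - ?a k x\<bar> \<le> \<bar>g x\<bar>" for k
        using assms(2,4) by eventually_elim (simp add: min_def)
      show "AE x in M. (\<lambda>k. g x - ?a k x) \<longlonglongrightarrow> 0"
        using assms(2,4,5)
      proof eventually_elim
        case (elim x)
        have "eventually (\<lambda>k. g x \<le> real k * w x) sequentially"
        proof (cases "g x = 0")
          case False
          then have "0 < w x" using elim by simp
          obtain N :: nat where "g x / w x \<le> real N" using real_arch_simple by blast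
          then have "g x \<le> real k * w x" if "k \<ge> N" for k
            using that \<open>0 < w x\<close> by (simp add: divide_le_eq) (meson mult_right_mono of_nat_mono order_trans less_imp_le)
          then show ?thesis by (auto simp: eventually_sequentially)
        qed (use elim in simp)
        then have "eventually (\<lambda>k. g x - ?a k x = 0) sequentially"
          by eventually_elim simp
        then show ?case by (rule tendsto_eventually)
      qed
    qed measurable
  qed
qed

lemma vanishing_of_Rn_vanishing:
  assumes g: "g \<in> real_Lp M p" and "vanishing (Rn m g)"
  shows "vanishing g"
proof -
  have "I (Rn (n + m) g) = I (Rn n (Rn m g))" for n
    by (intro pth_power_integral_cong pow.R_in_real_Lp g Rn_add_exponent)
  then have "(\<lambda>n. I (Rn (n + m) g)) \<longlonglongrightarrow> 0"
    using assms(2) by (simp add: vanishing_def)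
  then show ?thesis using g by (simp add: vanishing_def LIMSEQ_offset)
qed

lemma vanishing_fixed_eq_0:
  assumes "vanishing h" "AE x in M. R h x = h x"
  shows "AE x in M. h x = 0"
proof -
  note hL = vanishing_real_Lp[OF assms(1)]
  have "I (Rn n h) = I h" for n
    by (intro pth_power_integral_cong pow.R_in_real_Lp hL fixed_funpow assms(2))
  then have "(\<lambda>n. I h) \<longlonglongrightarrow> 0" using assms(1) by (simp add: vanishing_def)
  then have "I h = 0" by (simp add: LIMSEQ_const_iff)
  then show ?thesis by (rule pth_power_integral_eq_0D[OF hL])
qed

text \<open>
  The function \<open>h\<close> is the limit of the increasing orbit of \<open>|f|\<close>; it is fixed because \<open>T\<close> is
  continuous, and the orbit of \<open>h - |f|\<close> is the sequence of distances of that limit to the orbit.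
\<close>

lemma fixed_majorant:
  assumes f: "f \<in> Lp M p" and ev: "AE x in M. T f x = \<nu> * f x" and \<nu>: "norm \<nu> = 1"
  obtains h where "h \<in> real_Lp M p" "AE x in M. norm (f x) \<le> h x" "AE x in M. R h x = h x"
    "vanishing (\<lambda>x. h x - norm (f x))"
proof -
  note fL = norm_in_real_Lp[OF f]
  define a where "a = (\<lambda>n. Rn n (\<lambda>x. norm (f x)))"
  have aL: "a n \<in> real_Lp M p" for n unfolding a_def by (rule pow.R_in_real_Lp[OF fL])
  have a0: "AE x in M. 0 \<le> a n x" for n unfolding a_def by (rule pow.R_nonneg[OF fL]) simp
  have a_Suc: "AE x in M. a n x \<le> a (Suc n) x" for n
    using pow.R_mono[OF fL R_in_real_Lp[OF fL] norm_eigenfunction_le[OF f ev \<nu>], of n]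
      Rn_Suc(2)[OF fL, of n]
    unfolding a_def by eventually_elim (simp only:)
  have aI: "I (a n) \<le> K * I (\<lambda>x. norm (f x))" for n
    unfolding a_def by (rule Rn_bounded[OF fL])
  obtain h where h: "h \<in> real_Lp M p" "\<And>n. AE x in M. a n x \<le> h x"
    "(\<lambda>n. I (\<lambda>x. h x - a n x)) \<longlonglongrightarrow> 0"
    using real_Lp_monotone_limit[where a = a, OF p_pos(1) aL a0 a_Suc aI] by blast
  have fh: "AE x in M. norm (f x) \<le> h x" using h(2)[of 0] unfolding a_def Rn_0 .
  have bound: "I (\<lambda>x. R h x - h x) \<le> 2 powr p * (K * I (\<lambda>x. h x - a n x) + I (\<lambda>x. h x - a (Suc n) x))" for n
  proof -
    note dL = real_Lp_diff[OF p_pos(2) h(1) aL]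
    have dL': "(\<lambda>x. (-1) * (h x - a (Suc n) x)) \<in> real_Lp M p"
      by (rule real_Lp_cmult(1)[OF dL])
    have "AE x in M. R h x - h x = R (\<lambda>x. h x - a n x) x + (-1) * (h x - a (Suc n) x)"
      using R_diff[OF h(1) aL[of n]] Rn_Suc(1)[OF fL, of n]
      unfolding a_def by eventually_elim (simp del: funpow.simps)
    then have "I (\<lambda>x. R h x - h x) = I (\<lambda>x. R (\<lambda>x. h x - a n x) x + (-1) * (h x - a (Suc n) x))"
      by (intro pth_power_integral_cong real_Lp_diff real_Lp_add(1) R_in_real_Lp p_pos h(1) dL dL' aL)
    also have "\<dots> \<le> 2 powr p * (I (R (\<lambda>x. h x - a n x)) + I (\<lambda>x. (-1) * (h x - a (Suc n) x)))"
      by (intro real_Lp_add(2) R_in_real_Lp p_pos dL dL')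
    also have "I (\<lambda>x. (-1) * (h x - a (Suc n) x)) = I (\<lambda>x. h x - a (Suc n) x)"
      by (simp only: real_Lp_cmult(2)[OF dL]) simp
    also have "I (R (\<lambda>x. h x - a n x)) \<le> K * I (\<lambda>x. h x - a n x)"
      using Rn_bounded[OF dL[of n], of 1] by (simp only: Rn_1)
    finally show ?thesis by simp
  qed
  have "(\<lambda>n. 2 powr p * (K * I (\<lambda>x. h x - a n x) + I (\<lambda>x. h x - a (Suc n) x)))
      \<longlonglongrightarrow> 2 powr p * (K * 0 + 0)"
    by (intro tendsto_mult tendsto_add tendsto_const h(3) LIMSEQ_Suc[OF h(3)])
  then have "I (\<lambda>x. R h x - h x) \<le> 2 powr p * (K * 0 + 0)"
    by (rule LIMSEQ_le_const) (use bound in blast)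
  then have "I (\<lambda>x. R h x - h x) = 0"
    using pth_power_integral_nonneg[of M p "\<lambda>x. R h x - h x"] by simp
  then have "AE x in M. R h x - h x = 0"
    by (rule pth_power_integral_eq_0D[OF real_Lp_diff[OF p_pos(2) R_in_real_Lp[OF h(1)] h(1)]])
  then have fixed: "AE x in M. R h x = h x" by simp
  have "I (Rn n (\<lambda>x. h x - norm (f x))) = I (\<lambda>x. h x - a n x)" for n
  proof (intro pth_power_integral_cong pow.R_in_real_Lp real_Lp_diff p_pos h(1) fL aL)
    show "AE x in M. Rn n (\<lambda>x. h x - norm (f x)) x = h x - a n x"
      using pow.R_diff[OF h(1) fL, of n] fixed_funpow[OF h(1) fixed, of n]
      unfolding a_def by eventually_elim simp
  qed
  then have "vanishing (\<lambda>x. h x - norm (f x))"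
    using h(3) by (simp add: vanishing_def real_Lp_diff[OF p_pos(2) h(1) fL])
  with h(1) fh fixed show ?thesis by (rule that)
qed

text \<open>
  Outside the support of \<open>h - |f|\<close>, a point in the support of both \<open>T\<^sup>m g\<close> and \<open>T\<^sup>m\<^sup>+\<^sup>1 g\<close> would have
  \<open>\<nu>\<^sup>m f / h\<close> and \<open>\<nu>\<^sup>m\<^sup>+\<^sup>1 f / h\<close> both within \<open>2r\<close> of \<open>\<zeta>\<close>, although these have distance \<open>|\<nu> - 1| > 4r\<close>.
  So \<open>T\<^sup>m g\<close> is supported where \<open>h - |f|\<close> is nonzero.
\<close>

lemma vanishing_localised:
  fixes \<zeta> :: complex
  assumes f: "f \<in> Lp M p" and ev: "AE x in M. T f x = \<nu> * f x" and \<nu>: "norm \<nu> = 1"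
    and h: "h \<in> real_Lp M p" and fixed: "AE x in M. R h x = h x"
    and fh: "AE x in M. norm (f x) \<le> h x" and van: "vanishing (\<lambda>x. h x - norm (f x))"
    and g: "g \<in> real_Lp M p" and g0: "AE x in M. 0 \<le> g x" and gh: "AE x in M. g x \<le> h x"
    and "0 < r" and r: "4 * r < norm (\<nu> - 1)"
    and supp: "AE x in M. g x \<noteq> 0 \<longrightarrow> norm (f x - \<zeta> * h x) < r * h x"
    and grow: "AE x in M. Rn m g x \<noteq> 0 \<longrightarrow> Rn (Suc m) g x \<noteq> 0"
  shows "vanishing g"
proof (rule vanishing_of_Rn_vanishing[OF g, of m], rule vanishing_band[OF van])
  have nuk: "norm (\<nu> ^ k) = 1" for k using \<nu> by (simp add: norm_power)
  have loc: "AE x in M. norm (f x) = h x \<and> Rn k g x \<noteq> 0 \<longrightarrow>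
      norm (\<nu> ^ k * f x - \<zeta> * h x) \<le> 2 * r * h x" for k
    by (rule pow.localisation[OF f eigenfunction_funpow[OF f ev] nuk h fixed_funpow[OF h fixed]
          fh g g0 gh \<open>0 < r\<close> supp])
  show "AE x in M. 0 \<le> h x - norm (f x)" using fh by simp
  show "Rn m g \<in> real_Lp M p" by (rule pow.R_in_real_Lp[OF g])
  show nonneg: "AE x in M. 0 \<le> Rn m g x" by (rule pow.R_nonneg[OF g g0])
  show "AE x in M. Rn m g x \<noteq> 0 \<longrightarrow> h x - norm (f x) \<noteq> 0"
    using loc[of m] loc[of "Suc m"] grow nonneg pow.R_mono[OF g h gh, of m]
      fixed_funpow[OF h fixed, of m]
  proof eventually_elim
    case (elim x)
    show ?case
    proof (rule impI, rule notI)
      assume nz: "Rn m g x \<noteq> 0" and "h x - norm (f x) = 0"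
      then have eq: "norm (f x) = h x" by simp
      have h0: "0 < h x" using nz elim(4-6) by simp
      have "norm (\<nu> - 1) * h x = norm (\<nu> ^ m) * norm (\<nu> - 1) * norm (f x)"
        by (simp add: nuk eq)
      also have "\<dots> = norm ((\<nu> ^ Suc m * f x - \<zeta> * h x) - (\<nu> ^ m * f x - \<zeta> * h x))"
        by (simp add: algebra_simps flip: norm_mult)
      also have "\<dots> \<le> norm (\<nu> ^ Suc m * f x - \<zeta> * h x) + norm (\<nu> ^ m * f x - \<zeta> * h x)"
        by (rule norm_triangle_ineq4)
      also have "\<dots> \<le> 2 * r * h x + 2 * r * h x"
        using elim(1-3) nz eq by (intro add_mono) blast+
      finally have "norm (\<nu> - 1) * h x \<le> (4 * r) * h x" by simp
      then show False using r h0 by simp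
    qed
  qed
qed

end

section \<open>Triviality of the peripheral point spectrum\<close>

theorem theorem1p1:
  fixes M :: "'a measure" and p :: real
    and T :: "('a \<Rightarrow> complex) \<Rightarrow> ('a \<Rightarrow> complex)"
  assumes "sigma_finite_measure M"
    and "1 \<le> p"
    and "Lp_linear_operator M p T"
    and "positive_operator M p T"
    and "power_bounded M p T"
    and "\<forall>f\<in>Lp M p. ae_nonneg M f \<longrightarrow>
           (\<exists>n\<ge>1. ae_subset M (supp M ((T ^^ (n - 1)) f)) (supp M ((T ^^ n) f)))"
  shows "point_spectrum M p T \<inter> {z. norm z = 1} \<subseteq> {1}"
proof (rule subsetI, rule ccontr)
  fix l assume "l \<in> point_spectrum M p T \<inter> {z. norm z = 1}" and "l \<notin> {1}"
  then obtain f where f: "f \<in> Lp M p" and f0: "\<not> (AE x in M. f x = 0)"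
    and ev: "AE x in M. T f x = l * f x" and l: "norm l = 1" "l \<noteq> 1"
    by (auto simp: point_spectrum_def ae_eq_def)
  interpret positive_Lp_operator M p T by (intro positive_Lp_operator.intro assms)
  obtain K where
    "\<And>n f. f \<in> Lp M p \<Longrightarrow> pth_power_integral M p (\<lambda>x. norm ((T ^^ n) f x))
       \<le> K * pth_power_integral M p (\<lambda>x. norm (f x))"
    using power_bounded_pth_power_integral[OF assms(2)
        positive_Lp_operator_funpow[OF positive_Lp_operator_axioms] assms(5)] by blast
  then interpret power_bounded_positive_operator M p T K by unfold_locales
  obtain h where h: "h \<in> real_Lp M p" and fh: "AE x in M. norm (f x) \<le> h x"
    and fixed: "AE x in M. R h x = h x" and van: "vanishing (\<lambda>x. h x - norm (f x))"
    using fixed_majorant[OF f ev l(1)] by blast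
  note [measurable] = real_Lp_measurable[OF h] Lp_measurable[OF f]
  \<comment> \<open>The discs of radius \<open>2r\<close> around \<open>\<zeta>\<close> and around \<open>l * \<zeta>\<close> must be disjoint for \<open>\<zeta>\<close> on the circle.\<close>
  define r where "r = norm (l - 1) / 5"
  have r: "0 < r" "4 * r < norm (l - 1)" using l(2) by (auto simp: r_def)
  obtain Z :: "complex set" where Z: "finite Z" "cball 0 1 \<subseteq> (\<Union>\<zeta>\<in>Z. ball \<zeta> r)"
  proof (rule compactE_image[of "cball (0::complex) 1" "cball 0 1" "\<lambda>\<zeta>. ball \<zeta> r"])
    show "cball 0 1 \<subseteq> (\<Union>\<zeta>\<in>cball 0 1. ball (\<zeta>::complex) r)" using r(1) by fastforce
  qed auto
  define g where "g = (\<lambda>\<zeta>::complex. \<lambda>x. if norm (f x - \<zeta> * h x) < r * h x then h x else 0)"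
  have g_meas [measurable]: "g \<zeta> \<in> borel_measurable M" for \<zeta> unfolding g_def by measurable
  have gL: "g \<zeta> \<in> real_Lp M p" for \<zeta>
    by (rule real_Lp_dominated(1)[OF p_pos(2) h g_meas]) (simp add: g_def)
  have h0: "AE x in M. 0 \<le> h x" using fh by eventually_elim (rule order_trans[OF norm_ge_zero])
  have g0: "AE x in M. 0 \<le> g \<zeta> x" for \<zeta> using h0 by eventually_elim (simp add: g_def)
  have "vanishing (g \<zeta>)" for \<zeta>
  proof -
    let ?G = "\<lambda>x. complex_of_real (g \<zeta> x)"
    have "?G \<in> Lp M p" using gL by (simp add: of_real_in_Lp_iff)
    moreover have "ae_nonneg M ?G" using g0[of \<zeta>] by (simp add: ae_nonneg_def)
    ultimately obtain n where "n \<ge> 1"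
      and n: "ae_subset M (supp M ((T ^^ (n - 1)) ?G)) (supp M ((T ^^ n) ?G))"
      using assms(6) by blast
    then obtain m where m: "n = Suc m" by (cases n) auto
    have grow: "AE x in M. Rn m (g \<zeta>) x \<noteq> 0 \<longrightarrow> Rn (Suc m) (g \<zeta>) x \<noteq> 0"
      using n[unfolded m ae_subset_def supp_def] AE_space pow.S_of_real[OF gL[of \<zeta>], of m]
        pow.S_of_real[OF gL[of \<zeta>], of "Suc m"]
      by eventually_elim auto
    have gh: "AE x in M. g \<zeta> x \<le> h x" using h0 by eventually_elim (simp add: g_def)
    have gsupp: "AE x in M. g \<zeta> x \<noteq> 0 \<longrightarrow> norm (f x - \<zeta> * h x) < r * h x"
      by (simp add: g_def)
    show ?thesis
      by (rule vanishing_localised[OF f ev l(1) h fixed fh van gL g0 gh r gsupp grow])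
  qed
  then have "vanishing (\<lambda>x. \<Sum>\<zeta>\<in>Z. g \<zeta> x)" by (rule vanishing_sum[OF Z(1)])
  then have "vanishing h"
  proof (rule vanishing_dominated[OF _ h h0])
    show "AE x in M. h x \<le> (\<Sum>\<zeta>\<in>Z. g \<zeta> x)"
      using fh h0
    proof eventually_elim
      case (elim x)
      have nonneg: "0 \<le> g \<zeta> x" for \<zeta> using elim by (simp add: g_def)
      show ?case
      proof (cases "h x = 0")
        case True
        then show ?thesis by (simp add: sum_nonneg nonneg)
      next
        case False
        then have hx: "0 < h x" using elim by simp
        then have "f x / h x \<in> cball 0 1" using elim by (simp add: norm_divide)
        then obtain \<zeta> where \<zeta>: "\<zeta> \<in> Z" "norm (f x / h x - \<zeta>) < r"
          using Z(2) by (auto simp: dist_norm norm_minus_commute)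
        have "norm (f x - \<zeta> * h x) = norm ((f x / h x - \<zeta>) * h x)"
          using hx by (simp add: algebra_simps)
        also have "\<dots> = norm (f x / h x - \<zeta>) * h x" using hx by (simp only: norm_mult) simp
        also have "\<dots> < r * h x" using \<zeta>(2) hx by simp
        finally have "h x = g \<zeta> x" by (simp add: g_def)
        also have "\<dots> \<le> (\<Sum>\<zeta>\<in>Z. g \<zeta> x)"
          by (rule member_le_sum[OF \<zeta>(1)]) (use nonneg Z(1) in auto)
        finally show ?thesis .
      qed
    qed
  qed
  then have "AE x in M. h x = 0" using fixed by (rule vanishing_fixed_eq_0)
  with fh have "AE x in M. f x = 0" by eventually_elim simp
  with f0 show False ..
qed

end
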